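(* For $n\ge 0$ let $B_n(x)=\sum_{k=0}^{n}B(n,k)\,x^k$ be the $n$-th Baxter polynomial, where $B(n,k)=\dfrac{\binom{n}{k}\binom{n+1}{k}\binom{n+2}{k}}{\binom{k+1}{k}\binom{k+2}{k}}$ for $0\le k\le n$. Then the sequence $(B_n(x))_{n\ge 0}$ is $q$-log-convex; that is, for every $n\ge 1$ all coefficients of the polynomial $B_{n-1}(x)B_{n+1}(x)-B_n(x)^2$ in $x$ are nonnegative.
   Context: A sequence of real polynomials $(f_n(x))_{n\ge0}$ is called $q$-log-convex if for every $n\ge 1$ the polynomial $f_{n-1}(x)f_{n+1}(x)-f_n(x)^2$ has only nonnegative coefficients (the name comes from using $q$ as the polynomial variable; here the variable is $x$). *)

theory Defs
  imports Complex_Main "HOL-Computational_Algebra.Polynomial"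
begin

definition q_log_convex :: "(nat \<Rightarrow> real poly) \<Rightarrow> bool" where
  "q_log_convex f \<longleftrightarrow>
     (\<forall>n\<ge>1. \<forall>i. coeff (f (n - 1) * f (n + 1) - (f n)\<^sup>2) i \<ge> 0)"

definition baxter_coeff :: "nat \<Rightarrow> nat \<Rightarrow> real" where
  "baxter_coeff n k =
     (real (n choose k) * real ((n + 1) choose k) * real ((n + 2) choose k)) /
     (real ((k + 1) choose k) * real ((k + 2) choose k))"

definition baxter_poly :: "nat \<Rightarrow> real poly" where
  "baxter_poly n = (\<Sum>k\<le>n. monom (baxter_coeff n k) k)"

end

theory Submission
  imports Defs "HOL-Analysis.Gamma_Function"
begin

text \<open>
  Every coefficient of \<open>B\<^sub>n\<^sub>-\<^sub>1(x) B\<^sub>n\<^sub>+\<^sub>1(x) - B\<^sub>n(x)\<^sup>2\<close> is rewritten as a sum of nonnegative terms.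
  Write \<open>j = r - k\<close>. Averaging over the exchange of \<open>k\<close> and \<open>j\<close>, twice the coefficient of
  \<open>x\<^sup>r\<close> is the sum over \<open>k\<close> of
  \[ B(n-1,k) B(n+1,j) + B(n-1,j) B(n+1,k) - 2 B(n,k) B(n,j). \]
  These terms change sign: they are negative for \<open>k\<close> near \<open>j\<close> and positive in the tails. The cure is
  to subtract a difference \<open>G(k+1) - G(k)\<close> that sums to zero. With \<open>cub x = (x-1)x(x+1)\<close>,
  \[ G(k) = B(n,k-1) B(n,j) \frac{(U - V)^2}{X U - Z V}, \]
  up to a constant factor, where \<open>X, Z, U, V\<close> are the values of \<open>cub\<close> at
  \<open>j+2\<close>, \<open>k+1\<close>, \<open>n-k+2\<close>, \<open>n-j+1\<close>. The quotient comes from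
  the limit of large \<open>n\<close>, where to leading order its own variation is negligible beside that of the
  Baxter numbers and \<open>G\<close> cancels the terms completely. For finite \<open>n\<close>, two elementary identities for
  \<open>(U - V)\<^sup>2 / (XU - ZV)\<close> (lemma \<open>cert_cross\<close>) turn what remains into
  \<open>B(n,k) B(n,j)\<close> times the difference, between \<open>k+1\<close> and \<open>k\<close>, of the cross ratio
  \<open>(X - Z)(U - V) / (XU - ZV)\<close>, plus a constant multiple of \<open>B(n,k) B(n,j)\<close>.

  Put \<open>\<eta> = j - k + 1\<close>. The cross ratio is a function of \<open>\<eta>\<close> alone once \<open>n\<close> and \<open>r\<close> are fixed;
  multiplied by \<open>n + 3\<close> it is \<open>3\<eta> - 8 psi(\<eta>)\<close> with an odd function \<open>psi\<close> (lemma \<open>cross_eq_psi\<close>),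
  and the linear part cancels the constant. The outcome (lemma \<open>baxter_det_coeff\<close>) is
  \[ n [x^r] (B_{n-1} B_{n+1} - B_n^2)
     = 4 \sum_k B(n,k) B(n,r-k) (\psi(r-2k+1) - \psi(r-2k-1)). \]
  Since \<open>psi\<close> increases on \<open>\<eta> \<ge> 1\<close>, vanishes at \<open>0\<close> and \<open>\<plusminus>1\<close>, and is odd, it never
  decreases from \<open>e - 1\<close> to \<open>e + 1\<close> for an integer \<open>e\<close> (lemma \<open>psi_step_mono\<close>), and
  the theorem follows.
\<close>

section \<open>A closed form for the Baxter numbers\<close>

text \<open>
  Rising products of three factors play the role of a cube. They are centred at the middle
  factor, so that \<open>cub x = x\<^sup>3 - x\<close> is odd and differences factor conveniently.
\<close>

definition cub :: "real \<Rightarrow> real" where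
  "cub x = (x - 1) * x * (x + 1)"

text \<open>
  The reciprocal of \<open>x! (x+1)! (x+2)!\<close>. The reciprocal Gamma function makes it vanish
  at the negative integers, so that the recurrence \<open>invfact3_pred\<close> holds for every argument and
  terms outside the range of summation need no separate treatment.
\<close>

definition invfact3 :: "real \<Rightarrow> real" where
  "invfact3 x = rGamma (x + 1) * rGamma (x + 2) * rGamma (x + 3)"

lemma invfact3_pred: "invfact3 (x - 1) = cub (x + 1) * invfact3 x"
proof -
  have "rGamma x = x * rGamma (x + 1)"
    by (simp add: rGamma_plus1)
  moreover have "rGamma (x + 1) = (x + 1) * rGamma (x + 2)"
    using rGamma_plus1[of "x + 1"] by (simp add: add.assoc)
  moreover have "rGamma (x + 2) = (x + 2) * rGamma (x + 3)"
    using rGamma_plus1[of "x + 2"] by (simp add: add.assoc)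
  ultimately show ?thesis
    by (simp add: invfact3_def cub_def algebra_simps)
qed

lemma invfact3_of_nat: "invfact3 (real m) = 1 / (fact m * fact (m + 1) * fact (m + 2))"
proof -
  have "rGamma (real m + 1 + real i) = 1 / fact (m + i)" for i
    using Gamma_fact[of "m + i", where ?'a = real]
    by (simp add: rGamma_inverse_Gamma inverse_eq_divide add_ac)
  from this[of 0] this[of 1] this[of 2] show ?thesis
    by (simp add: invfact3_def add.assoc)
qed

lemma invfact3_diff_eq_0:
  assumes "m < l"
  shows "invfact3 (real m - real l) = 0"
proof -
  have "real m - real l + 1 = - real (l - m - 1)"
    using assms by (simp add: of_nat_diff)
  then have "real m - real l + 1 \<in> \<int>\<^sub>\<le>\<^sub>0"
    by (metis minus_of_nat_in_nonpos_Ints)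
  then show ?thesis
    by (simp add: invfact3_def rGamma_eq_zero_iff)
qed

definition baxter_scale :: "nat \<Rightarrow> real" where
  "baxter_scale n = 2 * fact n * fact (n + 1) * fact (n + 2)"

text \<open>
  The \<open>k\<close>-th Baxter number counts plane partitions in a \<open>k\<close> by \<open>n - k\<close> by \<open>3\<close> box; this is its
  product formula. It makes the symmetry under \<open>k \<mapsto> n - k\<close> visible and
  reduces every ratio of neighbouring Baxter numbers to \<open>invfact3_pred\<close>.
\<close>

lemma baxter_coeff_eq_invfact3:
  "baxter_coeff n k = baxter_scale n * invfact3 (real k) * invfact3 (real n - real k)"
proof (cases "k \<le> n")
  case True
  have *: "real (m + k choose k) = fact (m + k) / (fact k * fact m)" for m
    using binomial_fact[of k "m + k", where ?'a = real] by simp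
  obtain m where n: "n = m + k"
    using True by (metis le_add_diff_inverse2)
  have diff: "real n - real k = real m"
    by (simp add: n)
  have choose: "real (n choose k) = fact n / (fact k * fact m)"
    "real ((n + 1) choose k) = fact (n + 1) / (fact k * fact (m + 1))"
    "real ((n + 2) choose k) = fact (n + 2) / (fact k * fact (m + 2))"
    "real ((k + 1) choose k) = fact (k + 1) / fact k"
    "real ((k + 2) choose k) = fact (k + 2) / (fact k * fact 2)"
    using *[of m] *[of "m + 1"] *[of "m + 2"] *[of 1] *[of 2] by (simp_all add: n add_ac)
  show ?thesis
    unfolding baxter_coeff_def baxter_scale_def choose diff invfact3_of_nat
    by (simp add: field_simps fact_2 del: fact_Suc)
next
  case False
  then show ?thesis
    by (simp add: baxter_coeff_def invfact3_diff_eq_0)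
qed

lemma baxter_coeff_nonneg: "baxter_coeff n k \<ge> 0"
  by (simp add: baxter_coeff_def)

lemma baxter_coeff_eq_0: "n < k \<Longrightarrow> baxter_coeff n k = 0"
  by (simp add: baxter_coeff_def)

lemma coeff_baxter_poly: "coeff (baxter_poly n) k = baxter_coeff n k"
  by (auto simp: baxter_poly_def coeff_sum baxter_coeff_eq_0)

lemma baxter_scale_step:
  "real (n + 1) * (baxter_scale n * baxter_scale (n + 2))
     = real (n + 4) * (baxter_scale (n + 1))\<^sup>2"
  by (simp add: baxter_scale_def power2_eq_square)

section \<open>A monotone rational function\<close>

text \<open>
  In the application \<open>\<rho> = r + 3\<close>, \<open>\<sigma> = 2n - r + 3\<close> and \<open>\<eta> = j - k + 1\<close>. Up to elementary factors
  \<open>psi_denom\<close> is \<open>XU - ZV\<close> (see \<open>cub_cross_factor\<close>), written in the symmetric coordinates in which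
  the shift from \<open>k\<close> to \<open>k + 1\<close> changes only \<open>\<eta>\<close>.
\<close>

definition psi_denom :: "real \<Rightarrow> real \<Rightarrow> real \<Rightarrow> real" where
  "psi_denom \<rho> \<sigma> \<eta> = 3 * (\<rho>\<^sup>2 - 1) * (\<sigma>\<^sup>2 - 1)
     + (\<eta>\<^sup>2 - 1) * (\<rho>\<^sup>2 + 8 * \<rho> * \<sigma> + \<sigma>\<^sup>2 + 3 * \<eta>\<^sup>2 - 13)"

definition psi :: "real \<Rightarrow> real \<Rightarrow> real \<Rightarrow> real" where
  "psi \<rho> \<sigma> \<eta> = \<eta> * (\<eta>\<^sup>2 - 1) * (3 * \<rho> * \<sigma> + \<eta>\<^sup>2 - 4) / psi_denom \<rho> \<sigma> \<eta>"

text \<open>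
  Substituting \<open>\<rho>\<^sup>2 = P + 9\<close>, \<open>\<sigma>\<^sup>2 = S + 9\<close>, \<open>\<rho>\<sigma> = Q + 9\<close> and using the relation
  \<open>(P + 9)(S + 9) = (Q + 9)\<^sup>2\<close> between them leaves an expression with nonnegative coefficients.
\<close>

lemma psi_denom_pos:
  assumes "\<rho> \<ge> 3" "\<sigma> \<ge> 3"
  shows "psi_denom \<rho> \<sigma> \<eta> > 0"
proof -
  define P S H where "P = \<rho>\<^sup>2 - 9" and "S = \<sigma>\<^sup>2 - 9" and "H = \<eta>\<^sup>2"
  have "P \<ge> 0" "S \<ge> 0" "H \<ge> 0"
    using power_mono[OF assms(1), of 2] power_mono[OF assms(2), of 2]
    by (simp_all add: P_def S_def H_def)
  define Q where "Q = \<rho> * \<sigma> - 9"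
  have "Q \<ge> 0"
    using mult_mono[OF assms] assms by (simp add: Q_def)
  define R where "R = H * (P + S + 8 * Q + 3 * H + 74)"
  have "psi_denom \<rho> \<sigma> \<eta> = P * S + 5 * (P + S) + 2 * Q\<^sup>2 + 28 * Q + 115 + R"
    unfolding psi_denom_def P_def S_def H_def Q_def R_def by algebra
  also have "\<dots> > 0"
    unfolding R_def using \<open>P \<ge> 0\<close> \<open>S \<ge> 0\<close> \<open>H \<ge> 0\<close> \<open>Q \<ge> 0\<close>
    by (intro add_pos_nonneg[OF add_nonneg_pos]) simp_all
  finally show ?thesis .
qed

lemma psi_minus: "psi \<rho> \<sigma> (- \<eta>) = - psi \<rho> \<sigma> \<eta>"
  by (simp add: psi_def psi_denom_def)

text \<open>
  With \<open>t = \<eta>\<^sup>2 - 1\<close> the function is \<open>\<eta>\<close> times \<open>t(C + t) / (A + Bt + 3t\<^sup>2)\<close>. The second factor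
  increases in \<open>t \<ge> 0\<close> because \<open>A\<close>, \<open>C\<close> and \<open>B - 3C = (\<rho> - \<sigma>)\<^sup>2 + \<rho>\<sigma> - 1\<close> are nonnegative: in the
  cross-multiplied difference of two values the quartic terms cancel.
\<close>

lemma psi_mono:
  assumes "\<rho> \<ge> 3" "\<sigma> \<ge> 3" "1 \<le> \<eta>" "\<eta> \<le> \<theta>"
  shows "psi \<rho> \<sigma> \<eta> \<le> psi \<rho> \<sigma> \<theta>"
proof -
  define A B C where "A = 3 * (\<rho>\<^sup>2 - 1) * (\<sigma>\<^sup>2 - 1)"
    and "B = \<rho>\<^sup>2 + 8 * \<rho> * \<sigma> + \<sigma>\<^sup>2 - 10" and "C = 3 * \<rho> * \<sigma> - 3"
  define s t where "s = \<eta>\<^sup>2 - 1" and "t = \<theta>\<^sup>2 - 1"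
  have "0 \<le> s" "s \<le> t"
    using assms by (simp_all add: s_def t_def power_mono)
  have psi_eq: "psi \<rho> \<sigma> x = x * ((x\<^sup>2 - 1) * (C + (x\<^sup>2 - 1)) / (A + B * (x\<^sup>2 - 1) + 3 * (x\<^sup>2 - 1)\<^sup>2))"
    for x
  proof -
    have "psi_denom \<rho> \<sigma> x = A + B * (x\<^sup>2 - 1) + 3 * (x\<^sup>2 - 1)\<^sup>2"
      unfolding psi_denom_def A_def B_def by algebra
    moreover have "3 * \<rho> * \<sigma> + x\<^sup>2 - 4 = C + (x\<^sup>2 - 1)"
      by (simp add: C_def)
    ultimately show ?thesis
      by (simp add: psi_def)
  qed
  have sq: "\<rho>\<^sup>2 \<ge> 9" "\<sigma>\<^sup>2 \<ge> 9" "\<rho> * \<sigma> \<ge> 9"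
    using power_mono[OF assms(1), of 2] power_mono[OF assms(2), of 2] mult_mono[OF assms(1,2)] assms
    by simp_all
  have "A > 0" "C \<ge> 0"
    using sq by (simp_all add: A_def C_def)
  have "B - 3 * C = (\<rho> - \<sigma>)\<^sup>2 + \<rho> * \<sigma> - 1"
    unfolding B_def C_def by algebra
  then have "B - 3 * C \<ge> 0"
    using sq(3) zero_le_power2[of "\<rho> - \<sigma>"] by linarith
  have den: "A + B * x + 3 * x\<^sup>2 > 0" if "x \<ge> 0" for x
    using \<open>A > 0\<close> \<open>C \<ge> 0\<close> \<open>B - 3 * C \<ge> 0\<close> that by (intro add_pos_nonneg) auto
  have "s * (C + s) / (A + B * s + 3 * s\<^sup>2) \<le> t * (C + t) / (A + B * t + 3 * t\<^sup>2)"
  proof -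
    have "t * (C + t) * (A + B * s + 3 * s\<^sup>2) - s * (C + s) * (A + B * t + 3 * t\<^sup>2)
        = (t - s) * (A * C + A * (s + t) + (B - 3 * C) * s * t)"
      by algebra
    also have "\<dots> \<ge> 0"
      using \<open>0 \<le> s\<close> \<open>s \<le> t\<close> \<open>A > 0\<close> \<open>C \<ge> 0\<close> \<open>B - 3 * C \<ge> 0\<close> by simp
    finally show ?thesis
      using den[of s] den[of t] \<open>0 \<le> s\<close> \<open>s \<le> t\<close> by (simp add: divide_simps mult_ac)
  qed
  moreover have "0 \<le> s * (C + s) / (A + B * s + 3 * s\<^sup>2)"
    using den[of s] \<open>0 \<le> s\<close> \<open>C \<ge> 0\<close> by simp
  ultimately show ?thesis
    unfolding psi_eq using assms by (intro mult_mono) (auto simp: s_def t_def)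
qed

text \<open>
  Between \<open>-1\<close> and \<open>1\<close> the function is not monotone, but integer steps of length two
  see only the zeros at \<open>-1\<close>, \<open>0\<close>, \<open>1\<close> there.
\<close>

lemma psi_step_mono:
  assumes "\<rho> \<ge> 3" "\<sigma> \<ge> 3"
  shows "psi \<rho> \<sigma> (of_int e - 1) \<le> psi \<rho> \<sigma> (of_int e + 1)"
proof -
  have nonneg: "psi \<rho> \<sigma> (of_int i - 1) \<le> psi \<rho> \<sigma> (of_int i + 1)" if "i \<ge> 0" for i
  proof -
    have "i = 0 \<or> i = 1 \<or> i \<ge> 2"
      using that by linarith
    then consider "i = 0" | "i = 1" | "i \<ge> 2"
      by blast
    then show ?thesis
    proof cases
      case 2
      then show ?thesis
        using psi_mono[OF assms, of 1 2] by (simp add: psi_def)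
    next
      case 3
      then show ?thesis
        using assms by (intro psi_mono) auto
    qed (simp add: psi_def)
  qed
  show ?thesis
  proof (cases "e \<ge> 0")
    case False
    then show ?thesis
      using nonneg[of "- e"] psi_minus[of \<rho> \<sigma> "of_int e + 1"] psi_minus[of \<rho> \<sigma> "of_int e - 1"]
      by simp
  qed (rule nonneg)
qed

section \<open>The telescoping certificate\<close>

text \<open>
  In the range used below a vanishing denominator means \<open>u = v\<close> and \<open>x = z\<close> (see \<open>cub_cross_eq_0_D\<close>).
  Both quotients have the limit \<open>0\<close> there, which is also the default value of division by zero.
\<close>

definition cross :: "real \<Rightarrow> real \<Rightarrow> real \<Rightarrow> real \<Rightarrow> real" where
  "cross x z u v = (cub x - cub z) * (cub u - cub v) / (cub x * cub u - cub z * cub v)"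

definition cert :: "real \<Rightarrow> real \<Rightarrow> real \<Rightarrow> real \<Rightarrow> real" where
  "cert x z u v = (cub u - cub v)\<^sup>2 / (cub x * cub u - cub z * cub v)"

lemma cub_cross_factor:
  assumes "x - z = u - v"
  shows "16 * (cub x * cub u - cub z * cub v)
    = (u - v) * (x + v) * psi_denom (x + z) (u + v) (u - v)"
proof -
  have x: "x = z + u - v" using assms by simp
  show ?thesis
    unfolding x cub_def psi_denom_def by algebra
qed

lemma cub_cross_eq_0_D:
  assumes "x - z = u - v" "x + z \<ge> 3" "u + v \<ge> 3" "cub x * cub u = cub z * cub v"
  shows "u = v"
proof -
  have "x + v > 0"
    using assms(1-3) by linarith
  then show ?thesis
    using cub_cross_factor[OF assms(1)] psi_denom_pos[OF assms(2,3), of "u - v"] assms(4) by simp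
qed

text \<open>
  As long as \<open>\<eta> = u - v\<close> is small beside \<open>x + z\<close> and \<open>u + v\<close>, the cross ratio is nearly linear in \<open>\<eta>\<close>;
  \<open>psi\<close> is, up to the factor \<open>-8\<close>, the exact error of that approximation.
\<close>

lemma cross_eq_psi:
  assumes "x - z = u - v" "x + z \<ge> 3" "u + v \<ge> 3"
  shows "(x + v) * cross x z u v = 3 * (u - v) - 8 * psi (x + z) (u + v) (u - v)"
proof (cases "u = v")
  case True
  then show ?thesis by (simp add: cross_def psi_def)
next
  case False
  have pos: "x + v > 0" "psi_denom (x + z) (u + v) (u - v) > 0"
    using assms psi_denom_pos by auto
  define h E F where "h = u - v" and "E = psi_denom (x + z) (u + v) h"
    and "F = h * (h\<^sup>2 - 1) * (3 * (x + z) * (u + v) + h\<^sup>2 - 4)"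
  have x: "x = z + u - v" using assms by simp
  have "16 * ((cub x - cub z) * (cub u - cub v)) = h * (3 * h * E - 8 * F)"
    unfolding x cub_def psi_denom_def h_def E_def F_def by algebra
  moreover have "16 * (cub x * cub u - cub z * cub v) = h * (x + v) * E"
    using cub_cross_factor[OF assms(1)] by (simp add: E_def h_def)
  ultimately have "cross x z u v = (h * (3 * h * E - 8 * F)) / (h * (x + v) * E)"
    unfolding cross_def by (metis mult_divide_mult_cancel_left zero_neq_numeral)
  moreover have "h \<noteq> 0" "E > 0"
    using False pos by (simp_all add: h_def E_def)
  ultimately have "(x + v) * cross x z u v = (3 * h * E - 8 * F) / E"
    using pos(1) by simp
  also have "\<dots> = 3 * h - 8 * (F / E)"
    using \<open>E > 0\<close> by (simp add: diff_divide_distrib)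
  finally have "(x + v) * cross x z u v = 3 * h - 8 * (F / E)" .
  then show ?thesis
    by (simp add: psi_def E_def F_def h_def)
qed

text \<open>
  After multiplication by the common denominator these are the polynomial identities
  \<open>U(XU - ZV) - X(U - V)\<^sup>2 = V((XU - ZV) + (X - Z)(U - V))\<close> and its mirror image under the exchange of
  \<open>(X, U)\<close> with \<open>(Z, V)\<close>. They produce the factor \<open>V\<close> (respectively \<open>U\<close>) that is common to all the
  terms kept in \<open>pointwise_identity\<close>.
\<close>

lemma cert_cross:
  assumes "x - z = u - v" "x + z \<ge> 3" "u + v \<ge> 3"
  shows "cub u - cub x * cert x z u v = cub v * (1 + cross x z u v)"
    and "cub v + cub z * cert x z u v = cub u * (1 - cross x z u v)"
proof -
  define M where "M = cub x * cub u - cub z * cub v"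
  have "cub u - cub x * cert x z u v = cub v * (1 + cross x z u v) \<and>
        cub v + cub z * cert x z u v = cub u * (1 - cross x z u v)"
  proof (cases "M = 0")
    case True
    then show ?thesis
      using cub_cross_eq_0_D[OF assms] by (simp add: M_def cert_def cross_def)
  next
    case False
    have 1: "cub u * M - cub x * (cub u - cub v)\<^sup>2
        = cub v * (M + (cub x - cub z) * (cub u - cub v))"
      unfolding M_def by algebra
    have 2: "cub v * M + cub z * (cub u - cub v)\<^sup>2
        = cub u * (M - (cub x - cub z) * (cub u - cub v))"
      unfolding M_def by algebra
    from False 1 2 show ?thesis
      unfolding cert_def cross_def M_def[symmetric] by (simp add: field_simps)
  qed
  then show "cub u - cub x * cert x z u v = cub v * (1 + cross x z u v)"
    and "cub v + cub z * cert x z u v = cub u * (1 - cross x z u v)"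
    by auto
qed

text \<open>
  The left-hand side is the \<open>k\<close>-th symmetrised term, cleared of the weights and constants common to
  its three products; the last summand on the right is the telescoping part. Moving from \<open>k\<close> to \<open>k + 1\<close>
  lowers \<open>\<eta>\<close> by \<open>2\<close>, so the linear parts of the two cross ratios, scaled by \<open>n + 3\<close>, differ by \<open>6\<close>, and
  \<open>2(n + 3) - 6 = 2n\<close> accounts for the product with coefficient \<open>2n\<close>.
\<close>

lemma pointwise_identity:
  fixes k j a b n :: real
  assumes "n = k + a" "n = j + b" "k + j \<ge> 0" "a + b \<ge> 0"
  defines "\<Psi> \<equiv> psi (k + j + 3) (a + b + 3)"
  shows "(n + 3) * (cub (a + 1) * cub (a + 2) + cub (b + 1) * cub (b + 2))
           - 2 * n * (cub (a + 2) * cub (b + 2))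
       = 8 * (cub (a + 2) * cub (b + 2)) * (\<Psi> (j - k + 1) - \<Psi> (j - k - 1))
       + (n + 3) * (cub (j + 1) * cub (a + 2) * cert (j + 1) (k + 2) (a + 1) (b + 2)
                  - cub (k + 1) * cub (b + 2) * cert (j + 2) (k + 1) (a + 2) (b + 1))"
proof -
  let ?R = "cross (j + 2) (k + 1) (a + 2) (b + 1)"
  let ?R' = "cross (j + 1) (k + 2) (a + 1) (b + 2)"
  let ?Y = "cert (j + 2) (k + 1) (a + 2) (b + 1)"
  let ?Y' = "cert (j + 1) (k + 2) (a + 1) (b + 2)"
  have ab: "a - b = j - k"
    using assms by simp
  have "cub (a + 1) - cub (j + 1) * ?Y' = cub (b + 2) * (1 + ?R')"
    using assms ab by (intro cert_cross) auto
  moreover have "cub (b + 1) + cub (k + 1) * ?Y = cub (a + 2) * (1 - ?R)"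
    using assms ab by (intro cert_cross) auto
  moreover have "(n + 3) * ?R = 3 * (j - k + 1) - 8 * \<Psi> (j - k + 1)"
    using cross_eq_psi[of "j + 2" "k + 1" "a + 2" "b + 1"] assms ab
    by (simp add: \<Psi>_def algebra_simps)
  moreover have "(n + 3) * ?R' = 3 * (j - k - 1) - 8 * \<Psi> (j - k - 1)"
    using cross_eq_psi[of "j + 1" "k + 2" "a + 1" "b + 2"] assms ab
    by (simp add: \<Psi>_def algebra_simps)
  ultimately show ?thesis
    by algebra
qed

section \<open>The coefficients\<close>

text \<open>
  Up to the square of \<open>baxter_scale n\<close> this is \<open>B(n, k-1) B(n, r-k)\<close> times the certificate. It
  vanishes at \<open>k = 0\<close> and at \<open>k = r + 1\<close>, since \<open>invfact3 (-1) = 0\<close>.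
\<close>

definition cert_seq :: "nat \<Rightarrow> nat \<Rightarrow> nat \<Rightarrow> real" where
  "cert_seq n r k = invfact3 (real k - 1) * invfact3 (real r - real k)
     * invfact3 (real n - real k + 1) * invfact3 (real n - real r + real k)
     * cert (real r - real k + 2) (real k + 1) (real n - real k + 2) (real n - real r + real k + 1)"

text \<open>
  All Baxter numbers involved are multiples of the single weight \<open>fx * fj * fa * fb\<close> below, whose
  arguments are large enough that every factor produced by \<open>invfact3_pred\<close> lies in a numerator. This
  matters when \<open>j = n + 2\<close>: then \<open>B(n+1, j)\<close> vanishes although \<open>B(n+2, j)\<close> does not, and
  ratios to \<open>B(n+1, j)\<close> would make no sense.
\<close>

lemma baxter_det_term:
  fixes n r k :: nat
  assumes "k \<le> r" "r \<le> 2 * (n + 1)"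
  defines "\<Psi> \<equiv> psi (real r + 3) (2 * real (n + 1) - real r + 3)"
  shows "real (n + 1) * (baxter_coeff n k * baxter_coeff (n + 2) (r - k)
            + baxter_coeff n (r - k) * baxter_coeff (n + 2) k
            - 2 * (baxter_coeff (n + 1) k * baxter_coeff (n + 1) (r - k)))
    = 8 * (baxter_coeff (n + 1) k * baxter_coeff (n + 1) (r - k)
             * (\<Psi> (real r - 2 * real k + 1) - \<Psi> (real r - 2 * real k - 1)))
      + (baxter_scale (n + 1))\<^sup>2 * real (n + 4) * (cert_seq (n + 1) r (Suc k) - cert_seq (n + 1) r k)"
proof -
  define N x j where "N = real (n + 1)" and "x = real k" and "j = real (r - k)"
  define a b where "a = N - x" and "b = N - j"
  define fx fj fa fb where "fx = invfact3 x" and "fj = invfact3 j"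
    and "fa = invfact3 (a + 1)" and "fb = invfact3 (b + 1)"
  define C C0 C2 where "C = baxter_scale (n + 1)" and "C0 = baxter_scale n"
    and "C2 = baxter_scale (n + 2)"
  have r: "real r = x + j"
    using assms by (simp add: x_def j_def of_nat_diff)
  have n: "real n = N - 1" "real (n + 2) = N + 1" "real (n + 4) = N + 3"
    by (simp_all add: N_def)
  have a0: "invfact3 a = cub (a + 2) * fa" and b0: "invfact3 b = cub (b + 2) * fb"
    using invfact3_pred[of "a + 1"] invfact3_pred[of "b + 1"] by (simp_all add: fa_def fb_def add.assoc)
  have a1: "invfact3 (a - 1) = cub (a + 1) * (cub (a + 2) * fa)"
    and b1: "invfact3 (b - 1) = cub (b + 1) * (cub (b + 2) * fb)"
    using invfact3_pred[of a] invfact3_pred[of b] a0 b0 by simp_all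
  have x1: "invfact3 (x - 1) = cub (x + 1) * fx" and j1: "invfact3 (j - 1) = cub (j + 1) * fj"
    using invfact3_pred[of x] invfact3_pred[of j] by (simp_all add: fx_def fj_def)
  have B: "baxter_coeff (n + 1) k = C * fx * (cub (a + 2) * fa)"
    "baxter_coeff (n + 1) (r - k) = C * fj * (cub (b + 2) * fb)"
    using a0 b0 by (simp_all only: baxter_coeff_eq_invfact3 fx_def fj_def C_def a_def b_def
        x_def j_def N_def)
  have B0: "baxter_coeff n k = C0 * fx * (cub (a + 1) * (cub (a + 2) * fa))"
    "baxter_coeff n (r - k) = C0 * fj * (cub (b + 1) * (cub (b + 2) * fb))"
    using a1 b1 by (simp_all only: baxter_coeff_eq_invfact3 fx_def fj_def C0_def a_def b_def
        n x_def j_def Groups.diff_right_commute[of N 1])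
  have B2: "baxter_coeff (n + 2) k = C2 * fx * fa" "baxter_coeff (n + 2) (r - k) = C2 * fj * fb"
    unfolding baxter_coeff_eq_invfact3 fx_def fj_def fa_def fb_def C2_def a_def b_def
      n x_def j_def by (simp_all add: algebra_simps)
  let ?Y = "cert (j + 2) (x + 1) (a + 2) (b + 1)"
  let ?Y' = "cert (j + 1) (x + 2) (a + 1) (b + 2)"
  have G: "cert_seq (n + 1) r k = (cub (x + 1) * fx) * fj * fa * (cub (b + 2) * fb) * ?Y"
    unfolding x1[symmetric] b0[symmetric] fj_def fa_def cert_seq_def r
    by (simp add: a_def b_def N_def algebra_simps flip: x_def)
  have G': "cert_seq (n + 1) r (Suc k) = fx * (cub (j + 1) * fj) * (cub (a + 2) * fa) * fb * ?Y'"
    unfolding j1[symmetric] a0[symmetric] fx_def fb_def cert_seq_def r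
    by (simp add: a_def b_def N_def algebra_simps flip: x_def)
  have \<Psi>: "\<Psi> = psi (x + j + 3) (a + b + 3)"
    by (simp add: \<Psi>_def r a_def b_def N_def algebra_simps)
  have "real r \<le> 2 * N"
    using assms(2) by (simp add: N_def)
  then have "x + j \<ge> 0" "a + b \<ge> 0"
    unfolding r by (simp_all add: a_def b_def x_def j_def)
  then have key: "(N + 3) * (cub (a + 1) * cub (a + 2) + cub (b + 1) * cub (b + 2))
           - 2 * N * (cub (a + 2) * cub (b + 2))
       = 8 * (cub (a + 2) * cub (b + 2)) * (\<Psi> (j - x + 1) - \<Psi> (j - x - 1))
       + (N + 3) * (cub (j + 1) * cub (a + 2) * ?Y' - cub (x + 1) * cub (b + 2) * ?Y)"
    unfolding \<Psi> by (intro pointwise_identity) (simp_all add: a_def b_def)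
  have scale: "N * (C0 * C2) = (N + 3) * C\<^sup>2"
    using baxter_scale_step[of n] unfolding C_def C0_def C2_def n(3) N_def .
  have eta: "real r - 2 * real k = j - x"
    by (simp add: r flip: x_def)
  show ?thesis
    unfolding eta B B0 B2 G G' n(3) C_def[symmetric] N_def[symmetric]
    using key scale by algebra
qed

lemma baxter_det_coeff:
  assumes "r \<le> 2 * (n + 1)"
  defines "\<Psi> \<equiv> psi (real r + 3) (2 * real (n + 1) - real r + 3)"
  shows "real (n + 1) * coeff (baxter_poly n * baxter_poly (n + 2) - (baxter_poly (n + 1))\<^sup>2) r
    = 4 * (\<Sum>k\<le>r. baxter_coeff (n + 1) k * baxter_coeff (n + 1) (r - k)
             * (\<Psi> (real r - 2 * real k + 1) - \<Psi> (real r - 2 * real k - 1)))"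
proof -
  let ?f = "\<lambda>k. baxter_coeff n k * baxter_coeff (n + 2) (r - k)"
  let ?g = "\<lambda>k. baxter_coeff n (r - k) * baxter_coeff (n + 2) k"
  let ?h = "\<lambda>k. baxter_coeff (n + 1) k * baxter_coeff (n + 1) (r - k)"
  let ?G = "cert_seq (n + 1) r"
  have c: "coeff (baxter_poly n * baxter_poly (n + 2) - (baxter_poly (n + 1))\<^sup>2) r
      = (\<Sum>k\<le>r. ?f k) - (\<Sum>k\<le>r. ?h k)"
    by (simp add: coeff_mult power2_eq_square coeff_baxter_poly)
  have "(\<Sum>k\<le>r. ?g k) = (\<Sum>k\<le>r. ?f k)"
    by (rule sum.reindex_bij_witness[of _ "\<lambda>k. r - k" "\<lambda>k. r - k"]) auto
  then have "2 * (real (n + 1) * coeff (baxter_poly n * baxter_poly (n + 2) - (baxter_poly (n + 1))\<^sup>2) r)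
      = (\<Sum>k\<le>r. real (n + 1) * (?f k + ?g k - 2 * ?h k))"
    unfolding c sum_distrib_left[symmetric] sum_subtractf sum.distrib by (simp add: algebra_simps)
  also have "\<dots> = (\<Sum>k\<le>r. 8 * (?h k * (\<Psi> (real r - 2 * real k + 1) - \<Psi> (real r - 2 * real k - 1)))
      + (baxter_scale (n + 1))\<^sup>2 * real (n + 4) * (?G (Suc k) - ?G k))"
    unfolding \<Psi>_def by (intro sum.cong refl baxter_det_term) (use assms in auto)
  also have "\<dots> = 8 * (\<Sum>k\<le>r. ?h k * (\<Psi> (real r - 2 * real k + 1) - \<Psi> (real r - 2 * real k - 1)))
      + (baxter_scale (n + 1))\<^sup>2 * real (n + 4) * (\<Sum>k\<le>r. ?G (Suc k) - ?G k)"
    unfolding sum.distrib sum_distrib_left ..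
  also have "(\<Sum>k\<le>r. ?G (Suc k) - ?G k) = ?G (Suc r) - ?G 0"
    using sum_telescope[of ?G r] by (simp add: sum_subtractf)
  also have "\<dots> = 0"
    using invfact3_diff_eq_0[of 0 1] invfact3_diff_eq_0[of r "Suc r"]
    by (simp add: cert_seq_def)
  finally show ?thesis
    by simp
qed

theorem theorem5p1:
  shows "q_log_convex baxter_poly"
  unfolding q_log_convex_def
proof (intro allI impI)
  fix m r :: nat
  assume "m \<ge> 1"
  then obtain n where m: "m = n + 1"
    by (metis le_add_diff_inverse2)
  let ?p = "baxter_poly n * baxter_poly (n + 2) - (baxter_poly (n + 1))\<^sup>2"
  have "coeff ?p r \<ge> 0"
  proof (cases "r \<le> 2 * (n + 1)")
    case True
    let ?\<Psi> = "psi (real r + 3) (2 * real (n + 1) - real r + 3)"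
    have "?\<Psi> (real r - 2 * real k - 1) \<le> ?\<Psi> (real r - 2 * real k + 1)" for k
      using psi_step_mono[of "real r + 3" "2 * real (n + 1) - real r + 3" "int r - 2 * int k"] True
      by simp
    then have "real (n + 1) * coeff ?p r \<ge> 0"
      unfolding baxter_det_coeff[OF True]
      by (intro mult_nonneg_nonneg sum_nonneg) (auto simp: baxter_coeff_nonneg)
    then show ?thesis
      by (metis of_nat_0_less_iff zero_le_mult_iff not_le add_gr_0 zero_less_one)
  next
    case False
    \<comment> \<open>Both products have degree at most \<open>2 * (n + 1)\<close>.\<close>
    have "baxter_coeff n k * baxter_coeff (n + 2) (r - k) = 0"
      and "baxter_coeff (n + 1) k * baxter_coeff (n + 1) (r - k) = 0" for k
      using False by (cases "k \<le> n"; cases "k \<le> n + 1"; simp add: baxter_coeff_eq_0)+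
    then show ?thesis
      by (simp only: coeff_diff coeff_mult sum.neutral_const diff_self order.refl power2_eq_square coeff_baxter_poly)
  qed
  then show "coeff (baxter_poly (m - 1) * baxter_poly (m + 1) - (baxter_poly m)\<^sup>2) r \<ge> 0"
    by (simp add: m)
qed

end
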